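(* Let $(A,\circ,h)$ be a Euclidean metrized commutative algebra. (1) If $(A,\circ,h)$ has negative sectional nonassociativity, then $\mathrm{Aut}(A,\circ,h)$ is finite. (2) If $(A,\circ,h)$ has nonpositive sectional nonassociativity, then either $\mathrm{Aut}(A,\circ,h)$ is finite or $(A,\circ,h)$ contains a trivial subalgebra of dimension $1$ or $2$ (the possibilities are not exclusive).
   Context: An algebra is a finite-dimensional vector space $A$ with a bilinear multiplication $\circ$, not necessarily associative or unital. A Euclidean metrized commutative algebra is a real commutative algebra $(A,\circ)$ with a positive definite symmetric bilinear form $h$ that is invariant: $h(x\circ y,z)=h(x,y\circ z)$ for all $x,y,z\in A$. For linearly independent $x,y\in A$ (where $\dim A\ge2$), the sectional nonassociativity is $$\mathcal{K}(x,y)=\frac{h(x\circ x,y\circ y)-h(x\circ y,y\circ x)}{h(x,x)h(y,y)-h(x,y)^2},$$ which depends only on $\mathrm{Span}\{x,y\}$. The algebra has negative (resp. nonpositive) sectional nonassociativity if $\mathcal{K}(x,y)<0$ (resp. $\le0$) for all linearly independent $x,y$. $\mathrm{Aut}(A,\circ,h)$ is the group of algebra automorphisms of $(A,\circ)$ that preserve $h$. A subalgebra is trivial if the product of any two of its elements is zero. *)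

theory Defs
  imports "HOL-Analysis.Analysis"
begin

text \<open>The algebra is carried by a whole type of class \<open>real_vector\<close>, with finite dimension stated
  separately. The class \<open>euclidean_space\<close> would exclude dimension 0 and would come with a
  distinguished inner product besides \<open>h\<close>.\<close>

definition finite_dimensional :: "'a::real_vector itself \<Rightarrow> bool" where
  "finite_dimensional _ \<longleftrightarrow> (\<exists>B :: 'a set. finite B \<and> span B = UNIV)"

locale algebra_structure =
  fixes m :: "'a::real_vector \<Rightarrow> 'a \<Rightarrow> 'a"
  assumes finite_dim: "finite_dimensional TYPE('a)"
    and bilinear_mult: "bilinear m"

locale commutative_algebra_structure = algebra_structure +
  assumes mult_commute: "m x y = m y x"

locale euclidean_metrized_commutative_algebra = commutative_algebra_structure +
  fixes h :: "'a::real_vector \<Rightarrow> 'a \<Rightarrow> real"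
  assumes bilinear_form: "bilinear h"
    and form_sym: "h x y = h y x"
    and form_pos_def: "x \<noteq> 0 \<Longrightarrow> h x x > 0"
    and form_invariant: "h (m x y) z = h x (m y z)"

definition sectional_nonassociativity ::
  "('a::real_vector \<Rightarrow> 'a \<Rightarrow> 'a) \<Rightarrow> ('a \<Rightarrow> 'a \<Rightarrow> real) \<Rightarrow> 'a \<Rightarrow> 'a \<Rightarrow> real" where
  "sectional_nonassociativity m h x y =
     (h (m x x) (m y y) - h (m x y) (m y x)) / (h x x * h y y - (h x y)\<^sup>2)"

text \<open>Since \<open>{x, x} = {x}\<close>, linear independence of the family \<open>x, y\<close> needs \<open>x \<noteq> y\<close> in addition to
  independence of the set \<open>{x, y}\<close>.\<close>

definition lin_indep_pair :: "'a::real_vector \<Rightarrow> 'a \<Rightarrow> bool" where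
  "lin_indep_pair x y \<longleftrightarrow> x \<noteq> y \<and> independent {x, y}"

definition negative_sectional_nonassociativity ::
  "('a::real_vector \<Rightarrow> 'a \<Rightarrow> 'a) \<Rightarrow> ('a \<Rightarrow> 'a \<Rightarrow> real) \<Rightarrow> bool" where
  "negative_sectional_nonassociativity m h \<longleftrightarrow>
     (\<forall>x y. lin_indep_pair x y \<longrightarrow> sectional_nonassociativity m h x y < 0)"

definition nonpositive_sectional_nonassociativity ::
  "('a::real_vector \<Rightarrow> 'a \<Rightarrow> 'a) \<Rightarrow> ('a \<Rightarrow> 'a \<Rightarrow> real) \<Rightarrow> bool" where
  "nonpositive_sectional_nonassociativity m h \<longleftrightarrow>
     (\<forall>x y. lin_indep_pair x y \<longrightarrow> sectional_nonassociativity m h x y \<le> 0)"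

definition metrized_aut ::
  "('a::real_vector \<Rightarrow> 'a \<Rightarrow> 'a) \<Rightarrow> ('a \<Rightarrow> 'a \<Rightarrow> real) \<Rightarrow> ('a \<Rightarrow> 'a) set" where
  "metrized_aut m h =
     {f. linear f \<and> bij f \<and> (\<forall>x y. f (m x y) = m (f x) (f y)) \<and> (\<forall>x y. h (f x) (f y) = h x y)}"

definition is_subalgebra :: "('a::real_vector \<Rightarrow> 'a \<Rightarrow> 'a) \<Rightarrow> 'a set \<Rightarrow> bool" where
  "is_subalgebra m S \<longleftrightarrow> subspace S \<and> (\<forall>x\<in>S. \<forall>y\<in>S. m x y \<in> S)"

definition is_trivial_subalgebra :: "('a::real_vector \<Rightarrow> 'a \<Rightarrow> 'a) \<Rightarrow> 'a set \<Rightarrow> bool" where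
  "is_trivial_subalgebra m S \<longleftrightarrow> is_subalgebra m S \<and> (\<forall>x\<in>S. \<forall>y\<in>S. m x y = 0)"

end

theory Submission
  imports Defs
begin

text \<open>
  Suppose that the automorphism group is infinite. Automorphisms are isometries of a
  finite-dimensional inner product space, so they lie in a compact set and accumulate; the
  quotients of nearby automorphisms accumulate at the identity, and rescaled differences from the
  identity converge to a nonzero skew derivation \<open>D\<close> (\<open>infinite_aut_imp_derivation\<close>). This
  limit stands in for the Lie algebra of the automorphism group.

  Over the complex numbers, eigenvectors of \<open>D\<close> multiply like weight vectors: the product of
  eigenvectors for \<open>\<lambda>\<close> and \<open>\<mu>\<close> is zero or an eigenvector for \<open>\<lambda> + \<mu>\<close>. An eigenvector
  \<open>e + if\<close> whose eigenvalue has the largest modulus must therefore square to zero, since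
  twice that eigenvalue does not occur. In real terms \<open>e\<circ>e = f\<circ>f\<close> and \<open>e\<circ>f = 0\<close>, with
  \<open>e, f\<close> orthonormal, so the sectional nonassociativity of \<open>e, f\<close> is the squared norm of
  \<open>e\<circ>e\<close>. If it is not positive, all products of \<open>e\<close> and \<open>f\<close> vanish
  (\<open>derivation_null_pair\<close>).

  Both parts follow. The span of \<open>e, f\<close> is a trivial subalgebra of dimension two, and the
  sectional nonassociativity of \<open>e, f\<close> is zero, which rules out negativity.
\<close>

section \<open>Finite-dimensional inner products\<close>

locale finite_dim_inner_product =
  fixes h :: "'a::real_vector \<Rightarrow> 'a \<Rightarrow> real"
  assumes findim: "finite_dimensional TYPE('a)"
    and bilin: "bilinear h"
    and sym: "h x y = h y x"
    and pos_def: "x \<noteq> 0 \<Longrightarrow> h x x > 0"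
begin

lemmas inner_simps =
  bilinear_ladd[OF bilin] bilinear_radd[OF bilin] bilinear_lsub[OF bilin] bilinear_rsub[OF bilin]
  bilinear_lmul[OF bilin] bilinear_rmul[OF bilin] bilinear_lzero[OF bilin] bilinear_rzero[OF bilin]
  bilinear_lneg[OF bilin] bilinear_rneg[OF bilin]

lemma linear_left: "linear (\<lambda>x. h x y)"
  using bilin by (simp add: bilinear_def)

lemma sum_left: "h (\<Sum>i\<in>I. f i) y = (\<Sum>i\<in>I. h (f i) y)"
  by (rule linear_sum[OF linear_left])

lemma nonneg: "h x x \<ge> 0"
  using pos_def[of x] by (cases "x = 0") (auto simp: inner_simps)

lemma self_zero_iff: "h x x = 0 \<longleftrightarrow> x = 0"
  using pos_def[of x] by (cases "x = 0") (auto simp: inner_simps)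

lemma nonpos_imp_zero: "h x x \<le> 0 \<Longrightarrow> x = 0"
  using pos_def[of x] by fastforce

lemma eq_if_inner_eq: "x = y" if "\<And>z. h x z = h y z"
  using that[of "x - y"] self_zero_iff[of "x - y"] by (simp add: inner_simps)

definition orthonormal :: "'a set \<Rightarrow> bool" where
  "orthonormal B \<longleftrightarrow> (\<forall>b\<in>B. \<forall>c\<in>B. h b c = (if b = c then 1 else 0))"

definition orthonormal_basis :: "'a set \<Rightarrow> bool" where
  "orthonormal_basis B \<longleftrightarrow> finite B \<and> orthonormal B \<and> (\<forall>x. (\<Sum>b\<in>B. h x b *\<^sub>R b) = x)"

lemma inner_sum_orthonormal:
  assumes "finite B" "orthonormal B" "c \<in> B"
  shows "h (\<Sum>b\<in>B. u b *\<^sub>R b) c = u c"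
proof -
  have "h (\<Sum>b\<in>B. u b *\<^sub>R b) c = (\<Sum>b\<in>B. if b = c then u b else 0)"
    unfolding sum_left using assms
    by (intro sum.cong) (auto simp: inner_simps orthonormal_def)
  then show ?thesis using assms by simp
qed

lemma orthonormal_independent:
  assumes "finite B" "orthonormal B"
  shows "independent B"
proof (rule independent_if_scalars_zero)
  fix u v assume "(\<Sum>b\<in>B. u b *\<^sub>R b) = 0" "v \<in> B"
  then show "u v = 0"
    using inner_sum_orthonormal[OF assms, of v u] by (simp add: inner_simps)
qed fact

text \<open>An orthonormal set of greatest cardinality spans: otherwise the component of some vector
  orthogonal to it could be normalised and added.\<close>

lemma orthonormal_basis_exists: "\<exists>B. orthonormal_basis B"
proof -
  obtain S :: "'a set" where S: "finite S" "span S = UNIV"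
    using findim unfolding finite_dimensional_def by blast
  let ?P = "\<lambda>B. finite B \<and> orthonormal B"
  have "?P {}" by (simp add: orthonormal_def)
  moreover have "\<forall>B. ?P B \<longrightarrow> card B < Suc (card S)"
    using independent_span_bound[OF S(1) orthonormal_independent] S(2)
    by (simp add: less_Suc_eq_le)
  ultimately obtain B where B: "?P B" and max: "\<And>C. ?P C \<Longrightarrow> card C \<le> card B"
    using ex_has_greatest_nat[of ?P "{}" card "Suc (card S)"] by blast
  have "(\<Sum>b\<in>B. h x b *\<^sub>R b) = x" for x
  proof (rule ccontr)
    define y where "y = x - (\<Sum>b\<in>B. h x b *\<^sub>R b)"
    assume "(\<Sum>b\<in>B. h x b *\<^sub>R b) \<noteq> x"
    then have y: "h y y > 0" by (simp add: y_def pos_def)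
    have orth: "h y b = 0" if "b \<in> B" for b
      using B that by (simp add: y_def inner_simps inner_sum_orthonormal)
    define e where "e = (1 / sqrt (h y y)) *\<^sub>R y"
    have e1: "h e e = 1" using y by (simp add: e_def inner_simps)
    have eb: "h e b = 0" "h b e = 0" if "b \<in> B" for b
      using orth[OF that] sym[of b y] by (simp_all add: e_def inner_simps)
    have "e \<notin> B" using e1 eb by force
    moreover have "?P (insert e B)" using B e1 eb by (auto simp: orthonormal_def)
    ultimately show False using max[of "insert e B"] B by simp
  qed
  then show ?thesis using B unfolding orthonormal_basis_def by blast
qed

lemma parseval:
  assumes "orthonormal_basis B"
  shows "h x y = (\<Sum>b\<in>B. h x b * h y b)"
proof -
  have "h x y = h (\<Sum>b\<in>B. h x b *\<^sub>R b) y"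
    using assms by (simp add: orthonormal_basis_def)
  then show ?thesis by (simp add: sum_left inner_simps sym[of y])
qed

lemma linear_expand:
  assumes "orthonormal_basis B" "linear T"
  shows "T x = (\<Sum>b\<in>B. h x b *\<^sub>R T b)"
proof -
  have "T x = T (\<Sum>b\<in>B. h x b *\<^sub>R b)"
    using assms(1) by (simp add: orthonormal_basis_def)
  then show ?thesis using assms(2) by (simp add: linear_sum linear_cmul)
qed

section \<open>Convergence and compactness\<close>

text \<open>The underlying type carries no topology. Convergence is therefore expressed through the
  functionals \<^term>\<open>\<lambda>x. h x y\<close>; in finite dimension this is the usual convergence.\<close>

definition tends :: "(nat \<Rightarrow> 'a) \<Rightarrow> 'a \<Rightarrow> bool" where
  "tends X x \<longleftrightarrow> (\<forall>y. (\<lambda>n. h (X n) y) \<longlonglongrightarrow> h x y)"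

lemma tendsD: "tends X x \<Longrightarrow> (\<lambda>n. h (X n) y) \<longlonglongrightarrow> h x y"
  by (simp add: tends_def)

lemma tends_inner:
  assumes "tends X x" "tends Y y"
  shows "(\<lambda>n. h (X n) (Y n)) \<longlonglongrightarrow> h x y"
proof -
  obtain B where B: "orthonormal_basis B" using orthonormal_basis_exists by blast
  show ?thesis
    unfolding parseval[OF B, of "X _" "Y _"] parseval[OF B, of x y]
    by (intro tendsto_intros tendsD assms)
qed

lemma tends_linear:
  assumes "linear T" "tends X x"
  shows "tends (\<lambda>n. T (X n)) (T x)"
proof -
  obtain B where B: "orthonormal_basis B" using orthonormal_basis_exists by blast
  have expand: "h (T z) y = (\<Sum>b\<in>B. h z b * h (T b) y)" for z y
    by (subst linear_expand[OF B assms(1)]) (simp add: sum_left inner_simps)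
  show ?thesis
    unfolding tends_def expand[of "X _"] expand[of x]
    by (intro allI tendsto_intros tendsD assms)
qed

lemma tends_subseq:
  assumes "tends X x" "strict_mono r"
  shows "tends (\<lambda>n. X (r n)) x"
  using assms LIMSEQ_subseq_LIMSEQ[of "\<lambda>n. h (X n) _"] unfolding tends_def o_def by blast

text \<open>Allowing finitely many sequences at once gives, with a basis as index set, the compactness of
  bounded sets of linear maps, and with a single index that of bounded sets of vectors.\<close>

lemma bounded_family_subseq:
  assumes I: "finite I" and bd: "\<And>n i. i \<in> I \<Longrightarrow> h (X n i) (X n i) \<le> C"
  shows "\<exists>r x. strict_mono (r :: nat \<Rightarrow> nat) \<and> (\<forall>i\<in>I. tends (\<lambda>n. X (r n) i) (x i))"
proof -
  obtain B where B: "orthonormal_basis B" using orthonormal_basis_exists by blast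
  then have finB: "finite B" by (simp add: orthonormal_basis_def)
  define f where "f n = (\<lambda>(i, b). h (X n i) b)" for n
  have bnd: "bounded ((\<lambda>x. x k) ` range f)" if k: "k \<in> I \<times> B" for k
  proof -
    obtain i b where ib: "k = (i, b)" "i \<in> I" "b \<in> B" using k by auto
    have "\<bar>h (X n i) b\<bar> \<le> sqrt C" for n
    proof -
      have "(h (X n i) b)\<^sup>2 \<le> (\<Sum>c\<in>B. h (X n i) c * h (X n i) c)"
        using member_le_sum[of b B "\<lambda>c. h (X n i) c * h (X n i) c"] ib finB
        by (simp add: power2_eq_square)
      also have "\<dots> = h (X n i) (X n i)" by (rule parseval[OF B, symmetric])
      finally show ?thesis
        using bd[OF ib(2), of n] by (intro real_le_rsqrt) simp
    qed
    then show ?thesis by (auto simp: bounded_iff f_def ib)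
  qed
  obtain l and r :: "nat \<Rightarrow> nat" where r: "strict_mono r"
    and l: "\<And>e. e > 0 \<Longrightarrow>
      eventually (\<lambda>n. \<forall>k\<in>I \<times> B. dist (f (r n) k) (l k) < e) sequentially"
    using compact_lemma_general[of "I \<times> B" "\<lambda>x k. x k" f "\<lambda>x. x", OF _ bnd] I finB
    by (meson finite_SigmaI subset_refl)
  have lim: "(\<lambda>n. h (X (r n) i) b) \<longlonglongrightarrow> l (i, b)" if "i \<in> I" "b \<in> B" for i b
    unfolding tendsto_iff
  proof (intro allI impI)
    fix e :: real assume "e > 0"
    from l[OF this] show "\<forall>\<^sub>F n in sequentially. dist (h (X (r n) i) b) (l (i, b)) < e"
      by eventually_elim (use that in \<open>auto simp: f_def\<close>)
  qed
  define x where "x i = (\<Sum>b\<in>B. l (i, b) *\<^sub>R b)" for i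
  have "tends (\<lambda>n. X (r n) i) (x i)" if i: "i \<in> I" for i
    unfolding tends_def
  proof
    fix y
    have "h (x i) y = (\<Sum>b\<in>B. l (i, b) * h y b)"
      by (simp add: x_def sum_left inner_simps sym[of y])
    then show "(\<lambda>n. h (X (r n) i) y) \<longlonglongrightarrow> h (x i) y"
      unfolding parseval[OF B, of "X _ _" y] by (auto intro!: tendsto_intros lim i)
  qed
  then show ?thesis using r by blast
qed

lemma bounded_linear_maps_subseq:
  assumes B: "orthonormal_basis B" and lin: "\<And>n. linear (F n)"
    and bd: "\<And>n b. b \<in> B \<Longrightarrow> h (F n b) (F n b) \<le> C"
  shows "\<exists>r L. strict_mono (r :: nat \<Rightarrow> nat) \<and> linear L \<and> (\<forall>x. tends (\<lambda>n. F (r n) x) (L x))"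
proof -
  have finB: "finite B" using B by (simp add: orthonormal_basis_def)
  obtain r l where r: "strict_mono (r :: nat \<Rightarrow> nat)"
    and l: "\<And>b. b \<in> B \<Longrightarrow> tends (\<lambda>n. F (r n) b) (l b)"
    using bounded_family_subseq[of B F C, OF finB bd] by blast
  define L where "L x = (\<Sum>b\<in>B. h x b *\<^sub>R l b)" for x
  have "linear L"
    by (rule linearI)
      (simp_all add: L_def inner_simps scaleR_left_distrib sum.distrib scaleR_sum_right)
  moreover have "tends (\<lambda>n. F (r n) x) (L x)" for x
    unfolding tends_def
  proof
    fix y
    have F: "h (F (r n) x) y = (\<Sum>b\<in>B. h x b * h (F (r n) b) y)" for n
      unfolding linear_expand[OF B lin, of "r n" x] by (simp add: sum_left inner_simps)
    have L: "h (L x) y = (\<Sum>b\<in>B. h x b * h (l b) y)"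
      by (simp add: L_def sum_left inner_simps)
    show "(\<lambda>n. h (F (r n) x) y) \<longlonglongrightarrow> h (L x) y"
      unfolding F L by (intro tendsto_intros tendsD l)
  qed
  ultimately show ?thesis using r by blast
qed

lemma operator_norm_attained:
  assumes lin: "linear T" and nz: "(v::'a) \<noteq> 0"
  shows "\<exists>x. h x x = 1 \<and> (\<forall>y. h (T y) (T y) \<le> h (T x) (T x) * h y y)"
proof -
  define S where "S = (\<lambda>x. h (T x) (T x)) ` {x. h x x = 1}"
  have normalise: "h ((1 / sqrt (h y y)) *\<^sub>R y) ((1 / sqrt (h y y)) *\<^sub>R y) = 1" if "y \<noteq> 0" for y
    using pos_def[OF that] by (simp add: inner_simps)
  have "seq_compact S"
    unfolding seq_compact_def
  proof (intro allI impI)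
    fix u :: "nat \<Rightarrow> real" assume "\<forall>n. u n \<in> S"
    then obtain X where X: "\<And>n. h (X n) (X n) = 1" "\<And>n. u n = h (T (X n)) (T (X n))"
      unfolding S_def by (simp add: image_iff) metis
    obtain r x where r: "strict_mono (r :: nat \<Rightarrow> nat)" and x: "tends (\<lambda>n. X (r n)) x"
      using bounded_family_subseq[of "{()}" "\<lambda>n _. X n" 1] X(1) by auto
    have "h x x = 1"
      using tends_inner[OF x x] X(1) by (simp add: LIMSEQ_const_iff)
    moreover have "(u \<circ> r) \<longlonglongrightarrow> h (T x) (T x)"
      using tends_inner[OF tends_linear[OF lin x] tends_linear[OF lin x]] by (simp add: o_def X(2))
    ultimately show "\<exists>l\<in>S. \<exists>r. strict_mono r \<and> (u \<circ> r) \<longlonglongrightarrow> l"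
      using r unfolding S_def by blast
  qed
  then have "compact S" by (simp add: compact_eq_seq_compact_metric)
  moreover have "S \<noteq> {}" using normalise[OF nz] unfolding S_def by blast
  ultimately obtain x where x: "h x x = 1"
    and max: "\<And>y. h y y = 1 \<Longrightarrow> h (T y) (T y) \<le> h (T x) (T x)"
    using compact_attains_sup[of S] unfolding S_def by auto
  have "h (T y) (T y) \<le> h (T x) (T x) * h y y" for y
  proof (cases "y = 0")
    case True
    then show ?thesis using lin by (simp add: linear_0 inner_simps)
  next
    case False
    have "h (T y) (T y) / h y y \<le> h (T x) (T x)"
      using max[OF normalise[OF False]] pos_def[OF False] lin
      by (simp add: linear_cmul inner_simps divide_simps)
    then show ?thesis using pos_def[OF False] by (simp add: divide_simps)
  qed
  then show ?thesis using x by blast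
qed

text \<open>If \<open>D\<close> is skew, then \<open>D\<^sup>2\<close> is symmetric, and a vector at which \<open>D\<close> attains its norm
  \<open>c\<close> is an eigenvector of \<open>D\<^sup>2\<close>: the form \<open>c\<^sup>2 h(y, y) - h(Dy, Dy)\<close> is nonnegative, so by
  its Cauchy--Schwarz inequality a zero of it lies in its kernel.\<close>

lemma skew_extremal_eigenvector:
  assumes lin: "linear D" and skew: "\<And>x y. h (D x) y = - h x (D y)"
    and ext: "\<And>y. h (D y) (D y) \<le> c\<^sup>2 * h y y" and x: "h (D x) (D x) = c\<^sup>2 * h x x"
  shows "D (D x) = - (c\<^sup>2 *\<^sub>R x)"
proof -
  define w where "w = D (D x) + c\<^sup>2 *\<^sub>R x"
  define b where "b = c\<^sup>2 * h w w - h (D w) (D w)"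
  have b: "b \<ge> 0" using ext[of w] by (simp add: b_def)
  \<comment> \<open>This is the nonnegative form evaluated at \<open>x + tw\<close>; its term of degree zero vanishes.\<close>
  have key: "0 \<le> 2 * t * h w w + t\<^sup>2 * b" for t
  proof -
    have dd: "h (D x) (D w) = - h (D (D x)) w" using skew[of "D x" w] by simp
    have "h w w = h (D (D x)) w + c\<^sup>2 * h x w"
      by (subst (1) w_def) (simp add: inner_simps)
    moreover have "0 \<le> c\<^sup>2 * h (x + t *\<^sub>R w) (x + t *\<^sub>R w) - h (D (x + t *\<^sub>R w)) (D (x + t *\<^sub>R w))"
      using ext[of "x + t *\<^sub>R w"] by simp
    ultimately show ?thesis
      using x dd lin sym[of w x] sym[of "D w" "D x"]
      by (simp add: linear_add linear_cmul inner_simps b_def algebra_simps power2_eq_square)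
  qed
  have "h w w \<le> 0"
  proof (rule ccontr)
    assume "\<not> h w w \<le> 0"
    then have w: "h w w > 0" by simp
    \<comment> \<open>For small negative \<open>t\<close> the linear term of \<open>key\<close> dominates the quadratic one.\<close>
    define t where "t = - h w w / (1 + b)"
    have "t * (1 + b) = - h w w" using b by (simp add: t_def)
    then have "2 * t * h w w + t\<^sup>2 * b = - t\<^sup>2 * (2 + b)"
      by (simp add: power2_eq_square) algebra
    moreover have "t \<noteq> 0" using w b by (simp add: t_def)
    then have "t\<^sup>2 * (2 + b) > 0" using b by simp
    ultimately show False using key[of t] by simp
  qed
  then have "w = 0" by (rule nonpos_imp_zero)
  then show ?thesis by (simp add: w_def eq_neg_iff_add_eq_0)
qed

end

section \<open>A derivation from infinitely many automorphisms\<close>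

sublocale euclidean_metrized_commutative_algebra \<subseteq> finite_dim_inner_product h
  by unfold_locales (use finite_dim bilinear_form form_sym form_pos_def in auto)

context euclidean_metrized_commutative_algebra
begin

lemmas mult_simps =
  bilinear_ladd[OF bilinear_mult] bilinear_radd[OF bilinear_mult]
  bilinear_lsub[OF bilinear_mult] bilinear_rsub[OF bilinear_mult]
  bilinear_lmul[OF bilinear_mult] bilinear_rmul[OF bilinear_mult]
  bilinear_lneg[OF bilinear_mult] bilinear_rneg[OF bilinear_mult]

lemma linear_mult_left: "linear (\<lambda>x. m x y)"
  using bilinear_mult by (simp add: bilinear_def)

lemma aut_quotient:
  assumes f: "f \<in> metrized_aut m h" and g: "g \<in> metrized_aut m h"
  shows "inv f \<circ> g \<in> metrized_aut m h" "f ((inv f \<circ> g) x) = g x"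
proof -
  have bf: "bij f" and lf: "linear f" and bg: "bij g" and lg: "linear g"
    using f g by (auto simp: metrized_aut_def)
  have ff: "f (inv f x) = x" for x using bf by (simp add: bij_is_surj surj_f_inv_f)
  have inj: "x = y" if "f x = f y" for x y using that bf by (meson bij_is_inj injD)
  have "linear (inv f \<circ> g)"
    by (rule linearI; rule inj)
      (simp_all add: ff linear_add[OF lf] linear_add[OF lg] linear_cmul[OF lf] linear_cmul[OF lg])
  moreover have "bij (inv f \<circ> g)" using bf bg by (simp add: bij_comp bij_imp_bij_inv)
  moreover have "(inv f \<circ> g) (m x y) = m ((inv f \<circ> g) x) ((inv f \<circ> g) y)" for x y
    by (rule inj) (use f g in \<open>simp add: ff metrized_aut_def\<close>)
  moreover have "h ((inv f \<circ> g) x) ((inv f \<circ> g) y) = h x y" for x y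
  proof -
    have "h (inv f (g x)) (inv f (g y)) = h (f (inv f (g x))) (f (inv f (g y)))"
      using f by (simp add: metrized_aut_def)
    then show ?thesis using g by (simp add: ff metrized_aut_def)
  qed
  ultimately show "inv f \<circ> g \<in> metrized_aut m h" by (simp add: metrized_aut_def)
  show "f ((inv f \<circ> g) x) = g x" by (simp add: ff)
qed

text \<open>Automorphisms are isometries, so an infinite set of them contains a convergent sequence of
  distinct elements; the quotients of consecutive terms tend to the identity.\<close>

lemma auts_tending_to_id:
  assumes "infinite (metrized_aut m h)"
  shows "\<exists>g. (\<forall>n. g n \<in> metrized_aut m h \<and> g n \<noteq> id) \<and> (\<forall>x. tends (\<lambda>n. g n x) x)"
proof -
  obtain B where B: "orthonormal_basis B" using orthonormal_basis_exists by blast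
  obtain F :: "nat \<Rightarrow> 'a \<Rightarrow> 'a" where inj: "inj F" and F: "\<And>n. F n \<in> metrized_aut m h"
    using infinite_countable_subset[OF assms] by auto
  have lin: "linear (F n)" and iso: "h (F n x) (F n y) = h x y" for n x y
    using F[of n] by (auto simp: metrized_aut_def)
  have bd: "h (F n b) (F n b) \<le> 1" if "b \<in> B" for n b
    using B that by (simp add: iso orthonormal_basis_def orthonormal_def)
  obtain r L where r: "strict_mono (r :: nat \<Rightarrow> nat)"
    and L: "\<And>x. tends (\<lambda>n. F (r n) x) (L x)"
    using bounded_linear_maps_subseq[of B F 1, OF B lin bd] by blast
  define g where "g n = inv (F (r n)) \<circ> F (r (Suc n))" for n
  have gF: "F (r n) (g n x) = F (r (Suc n)) x" for n x
    unfolding g_def by (rule aut_quotient(2)[OF F F])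
  have "g n \<in> metrized_aut m h" for n
    unfolding g_def by (rule aut_quotient(1)[OF F F])
  moreover have "g n \<noteq> id" for n
  proof
    assume "g n = id"
    then have "F (r n) = F (r (Suc n))" using gF[of n] by auto
    then have "r n = r (Suc n)" using inj by (simp add: inj_eq)
    then show False using strict_monoD[OF r, of n "Suc n"] by simp
  qed
  moreover have "tends (\<lambda>n. g n x) x" for x
    unfolding tends_def
  proof
    fix y
    have "h (g n x) y = h (F (r (Suc n)) x) (F (r n) y)" for n
      using iso[of "r n" "g n x" y] by (simp add: gF)
    moreover have "tends (\<lambda>n. F (r (Suc n)) x) (L x)"
      using tends_subseq[OF L, of Suc] by (simp add: strict_mono_Suc_iff)
    ultimately have "(\<lambda>n. h (g n x) y) \<longlonglongrightarrow> h (L x) (L y)"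
      using tends_inner[OF _ L[of y]] by simp
    moreover have "h (L x) (L y) = h x y"
      using tends_inner[OF L[of x] L[of y]] by (simp add: iso LIMSEQ_const_iff)
    ultimately show "(\<lambda>n. h (g n x) y) \<longlonglongrightarrow> h x y" by simp
  qed
  ultimately show ?thesis by blast
qed

text \<open>The limit replaces the passage from a compact Lie group of positive dimension to its Lie
  algebra. Let \<open>g\<^sub>n\<close> be automorphisms other than the identity that tend to it. The difference
  quotients \<open>(g\<^sub>n - id) / t\<^sub>n\<close>, with \<open>t\<^sub>n\<close> the Hilbert--Schmidt norm of \<open>g\<^sub>n - id\<close>, have
  norm one, so a subsequence converges to a nonzero map. In the limit the quadratic error terms in
  the automorphism and isometry identities vanish.\<close>

lemma infinite_aut_imp_derivation:
  assumes "infinite (metrized_aut m h)"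
  shows "\<exists>D. linear D \<and> (\<exists>x. D x \<noteq> 0) \<and> (\<forall>x y. D (m x y) = m (D x) y + m x (D y)) \<and>
    (\<forall>x y. h (D x) y = - h x (D y))"
proof -
  obtain B where B: "orthonormal_basis B" using orthonormal_basis_exists by blast
  then have finB: "finite B" by (simp add: orthonormal_basis_def)
  obtain g where g: "\<And>n. g n \<in> metrized_aut m h" "\<And>n. g n \<noteq> id"
    and glim: "\<And>x. tends (\<lambda>n. g n x) x"
    using auts_tending_to_id[OF assms] by blast
  have ling: "linear (g n)" and iso: "h (g n x) (g n y) = h x y"
    and hom: "g n (m x y) = m (g n x) (g n y)" for n x y
    using g(1)[of n] by (auto simp: metrized_aut_def)
  define s where "s n = (\<Sum>b\<in>B. h (g n b - b) (g n b - b))" for n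
  define t where "t n = sqrt (s n)" for n
  have s0: "s n \<noteq> 0" for n
  proof
    assume "s n = 0"
    then have "g n b = b" if "b \<in> B" for b
      using that finB by (simp add: s_def sum_nonneg_eq_0_iff nonneg self_zero_iff)
    then have "g n x = x" for x
      using linear_expand[OF B ling, of n x] linear_expand[OF B linear_ident, of x] by simp
    then show False using g(2)[of n] by auto
  qed
  have spos: "s n > 0" for n
    using s0[of n] sum_nonneg[of B "\<lambda>b. h (g n b - b) (g n b - b)"]
    by (auto simp: s_def nonneg order_less_le)
  then have tpos: "t n > 0" and tsq: "t n * t n = s n" for n
    by (simp_all add: t_def less_imp_le)
  have diff0: "tends (\<lambda>n. g n b - b) 0" for b
    using tendsto_diff[OF tendsD[OF glim[of b]] tendsto_const]
    by (simp add: tends_def inner_simps tendsD[OF glim] LIM_zero)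
  have "s \<longlonglongrightarrow> (\<Sum>b\<in>B. h 0 0)"
    unfolding s_def by (intro tendsto_sum tends_inner diff0)
  then have tlim: "t \<longlonglongrightarrow> 0"
    unfolding t_def using tendsto_real_sqrt by (fastforce simp: inner_simps)
  define E where "E n x = (1 / t n) *\<^sub>R (g n x - x)" for n x
  have gE: "g n x = x + t n *\<^sub>R E n x" for n x
    using tpos[of n] by (simp add: E_def)
  have linE: "linear (E n)" for n
    by (rule linearI)
      (simp_all add: E_def linear_add[OF ling] linear_cmul[OF ling] algebra_simps)
  have normE: "(\<Sum>b\<in>B. h (E n b) (E n b)) = 1" for n
  proof -
    have "h (E n b) (E n b) = h (g n b - b) (g n b - b) / s n" for b
      by (simp add: E_def bilinear_lmul[OF bilin] bilinear_rmul[OF bilin] flip: tsq)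
    then show ?thesis using s0[of n] by (simp add: s_def flip: sum_divide_distrib)
  qed
  have bd: "h (E n b) (E n b) \<le> 1" if "b \<in> B" for n b
    using member_le_sum[of b B "\<lambda>b. h (E n b) (E n b)"] that finB normE[of n] nonneg by simp
  obtain r D where r: "strict_mono (r :: nat \<Rightarrow> nat)" and linD: "linear D"
    and D: "\<And>x. tends (\<lambda>n. E (r n) x) (D x)"
    using bounded_linear_maps_subseq[of B E 1, OF B linE bd] by blast
  have trlim: "(\<lambda>n. t (r n)) \<longlonglongrightarrow> 0"
    using LIMSEQ_subseq_LIMSEQ[OF tlim r] by (simp add: o_def)
  have "(\<lambda>n. \<Sum>b\<in>B. h (E (r n) b) (E (r n) b)) \<longlonglongrightarrow> (\<Sum>b\<in>B. h (D b) (D b))"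
    by (intro tendsto_sum tends_inner D)
  then have "(\<Sum>b\<in>B. h (D b) (D b)) = 1" by (simp add: normE LIMSEQ_const_iff)
  then have "\<exists>x. D x \<noteq> 0" by (rule contrapos_pp) (simp add: inner_simps)
  moreover have "D (m x y) = m (D x) y + m x (D y)" for x y
  proof (rule eq_if_inner_eq)
    fix z
    \<comment> \<open>The homomorphism identity for \<open>id + t\<^sub>n E\<^sub>n\<close>, divided by \<open>t\<^sub>n\<close>.\<close>
    have "t n *\<^sub>R E n (m x y) = t n *\<^sub>R (m (E n x) y + m x (E n y) + t n *\<^sub>R m (E n x) (E n y))" for n
      using hom[of n x y] by (simp add: gE mult_simps algebra_simps)
    then have eq: "E n (m x y) = m (E n x) y + m x (E n y) + t n *\<^sub>R m (E n x) (E n y)" for n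
      using tpos[of n] by (metis scaleR_cancel_left less_irrefl)
    \<comment> \<open>After this regrouping each term is a value of \<open>h\<close> at convergent vectors; the product
      \<open>m (E n x) (E n y)\<close> of two varying factors is gone.\<close>
    have inv: "h (m u v) z = h u (m v z)" "h (m u v) z = h v (m u z)" for u v
      using form_invariant mult_commute by metis+
    have "h (E n (m x y)) z = h (E n x) (m y z) + h (E n y) (m x z) + t n * h (E n x) (m (E n y) z)"
      for n
      by (simp add: eq inner_simps inv(1)[of "E n x"] inv(2)[of x])
    moreover have "(\<lambda>n. h (E (r n) x) (m y z) + h (E (r n) y) (m x z)
        + t (r n) * h (E (r n) x) (m (E (r n) y) z))
      \<longlonglongrightarrow> h (D x) (m y z) + h (D y) (m x z) + 0 * h (D x) (m (D y) z)"
      by (intro tendsto_intros tendsD D trlim tends_inner tends_linear[OF linear_mult_left])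
    ultimately have "(\<lambda>n. h (E (r n) (m x y)) z) \<longlonglongrightarrow> h (D x) (m y z) + h (D y) (m x z)"
      by simp
    from LIMSEQ_unique[OF tendsD[OF D] this]
    show "h (D (m x y)) z = h (m (D x) y + m x (D y)) z"
      by (simp add: inner_simps inv(1)[of "D x"] inv(2)[of x])
  qed
  moreover have "h (D x) y = - h x (D y)" for x y
  proof -
    have "t n * (h (E n x) y + h x (E n y) + t n * h (E n x) (E n y)) = 0" for n
      using iso[of n x y] by (simp add: gE inner_simps algebra_simps)
    then have "h (E n x) y + h (E n y) x + t n * h (E n x) (E n y) = 0" for n
      using tpos[of n] sym[of x] by (metis mult_eq_0_iff less_irrefl)
    moreover have "(\<lambda>n. h (E (r n) x) y + h (E (r n) y) x + t (r n) * h (E (r n) x) (E (r n) y))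
      \<longlonglongrightarrow> h (D x) y + h (D y) x + 0 * h (D x) (D y)"
      by (intro tendsto_intros tendsD D trlim tends_inner)
    ultimately show ?thesis using sym[of x "D y"] by (simp add: LIMSEQ_const_iff)
  qed
  ultimately show ?thesis using linD by blast
qed

section \<open>Derivations under nonpositive sectional nonassociativity\<close>

lemma orthonormal_pair:
  assumes "h e e = 1" "h f f = 1" "h e f = 0"
  shows "lin_indep_pair e f" "dim (span {e, f}) = 2"
proof -
  have "e \<noteq> f" using assms by auto
  moreover have "orthonormal {e, f}" using assms sym[of f e] by (auto simp: orthonormal_def)
  ultimately show "lin_indep_pair e f" "dim (span {e, f}) = 2"
    using orthonormal_independent[of "{e, f}"]
    by (auto simp: lin_indep_pair_def dim_eq_card_independent)
qed

text \<open>Let \<open>e\<close> be a unit vector at which \<open>D\<close> attains its norm \<open>c\<close>, and \<open>f = De / c\<close>, so that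
  \<open>e + if\<close> is an eigenvector of \<open>D\<close> for \<open>- ic\<close>. As \<open>D\<close> is a derivation, the square of
  \<open>e + if\<close> is zero or an eigenvector for \<open>- 2ic\<close>. The latter exceeds the norm of \<open>D\<close>, so the
  square \<open>(e\<circ>e - f\<circ>f) + 2i e\<circ>f\<close> vanishes. The numerator of the sectional nonassociativity of
  \<open>e, f\<close> is then \<open>h(e\<circ>e, e\<circ>e)\<close>, so nonpositivity forces \<open>e\<circ>e = 0\<close> as well.\<close>

lemma derivation_null_pair:
  assumes lin: "linear D" and nz: "D v \<noteq> 0"
    and der: "\<And>x y. D (m x y) = m (D x) y + m x (D y)"
    and skew: "\<And>x y. h (D x) y = - h x (D y)"
    and nonpos: "nonpositive_sectional_nonassociativity m h"
  shows "\<exists>e f. h e e = 1 \<and> h f f = 1 \<and> h e f = 0 \<and> m e e = 0 \<and> m e f = 0 \<and> m f f = 0"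
proof -
  obtain e where e: "h e e = 1" and ext0: "\<And>y. h (D y) (D y) \<le> h (D e) (D e) * h y y"
    using operator_norm_attained[OF lin, of "D v"] nz by blast
  define c where "c = sqrt (h (D e) (D e))"
  have c2: "c\<^sup>2 = h (D e) (D e)" by (simp add: c_def nonneg)
  have "h (D e) (D e) \<noteq> 0"
    using ext0[of v] pos_def[OF nz] by auto
  then have c: "c > 0" using nonneg[of "D e"] by (simp add: c_def)
  have ext: "h (D y) (D y) \<le> c\<^sup>2 * h y y" for y using ext0 by (simp add: c2)
  have DDe: "D (D e) = - (c\<^sup>2 *\<^sub>R e)"
    by (rule skew_extremal_eigenvector[OF lin skew ext]) (simp add: c2 e)
  define f where "f = (1 / c) *\<^sub>R D e"
  have De: "D e = c *\<^sub>R f" using c by (simp add: f_def)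
  have Df: "D f = - (c *\<^sub>R e)"
    using c lin by (simp add: f_def linear_cmul DDe power2_eq_square)
  have f: "h f f = 1"
    using c by (simp add: f_def inner_simps power2_eq_square flip: c2)
  have "h (D e) e = 0" using skew[of e e] sym[of e "D e"] by simp
  then have ef: "h e f = 0" using sym[of e "D e"] by (simp add: f_def inner_simps)
  define u where "u = m e f"
  define w where "w = m e e - m f f"
  have fe: "m f e = u" by (simp add: u_def mult_commute)
  have Du: "D u = - (c *\<^sub>R w)"
    by (simp add: u_def w_def der De Df mult_simps algebra_simps)
  have Dw: "D w = (4 * c) *\<^sub>R u"
  proof -
    have "D w = (c *\<^sub>R u + c *\<^sub>R u) + (c *\<^sub>R u + c *\<^sub>R u)"
      by (simp add: w_def linear_diff[OF lin] der De Df mult_simps fe flip: u_def)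
    then show ?thesis by (simp flip: scaleR_left_distrib)
  qed
  have "c\<^sup>2 * (16 * h u u) \<le> c\<^sup>2 * h w w"
    using ext[of w] by (simp add: Dw inner_simps power2_eq_square algebra_simps)
  moreover have "c\<^sup>2 * h w w \<le> c\<^sup>2 * h u u"
    using ext[of u] by (simp add: Du inner_simps power2_eq_square algebra_simps)
  \<comment> \<open>On the span of \<open>u, w\<close> the square of \<open>D\<close> is \<open>- 4c\<^sup>2\<close>, more than \<open>ext\<close> permits.\<close>
  ultimately have "16 * h u u \<le> h w w" "h w w \<le> h u u" using c by simp_all
  then have "u = 0" "w = 0" using nonneg[of u] by (auto intro!: nonpos_imp_zero)
  then have ef0: "m e f = 0" and sq: "m f f = m e e" by (simp_all add: u_def w_def)
  have "sectional_nonassociativity m h e f \<le> 0"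
    using nonpos orthonormal_pair(1)[OF e f ef]
    by (simp add: nonpositive_sectional_nonassociativity_def)
  then have "m e e = 0"
    by (intro nonpos_imp_zero)
      (simp add: sectional_nonassociativity_def e f ef ef0 sq inner_simps)
  then show ?thesis using e f ef ef0 sq by auto
qed

lemma infinite_aut_imp_null_pair:
  assumes "infinite (metrized_aut m h)" "nonpositive_sectional_nonassociativity m h"
  shows "\<exists>e f. h e e = 1 \<and> h f f = 1 \<and> h e f = 0 \<and> m e e = 0 \<and> m e f = 0 \<and> m f f = 0"
proof -
  obtain D v where "linear D" "D v \<noteq> 0" "\<And>x y. D (m x y) = m (D x) y + m x (D y)"
    "\<And>x y. h (D x) y = - h x (D y)"
    using infinite_aut_imp_derivation[OF assms(1)] by blast
  then show ?thesis by (rule derivation_null_pair) (rule assms(2))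
qed

lemma span_null_pair_trivial:
  assumes "m e e = 0" "m e f = 0" "m f f = 0"
  shows "is_trivial_subalgebra m (span {e, f})"
proof -
  have fe: "m f e = 0" using assms(2) mult_commute by metis
  have comb: "\<exists>a b. x = a *\<^sub>R e + b *\<^sub>R f" if z: "x \<in> span {e, f}" for x
  proof -
    obtain a b where "x - a *\<^sub>R e - b *\<^sub>R f = 0"
      using z by (auto simp: span_breakdown_eq)
    then have "x = a *\<^sub>R e + b *\<^sub>R f" by (simp add: algebra_simps)
    then show ?thesis by blast
  qed
  have "m x y = 0" if xy: "x \<in> span {e, f}" "y \<in> span {e, f}" for x y
  proof -
    obtain a b a' b' where x: "x = a *\<^sub>R e + b *\<^sub>R f" and y: "y = a' *\<^sub>R e + b' *\<^sub>R f"
      using comb[OF xy(1)] comb[OF xy(2)] by blast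
    show ?thesis by (simp add: x y mult_simps assms fe)
  qed
  then show ?thesis
    by (simp add: is_trivial_subalgebra_def is_subalgebra_def span_zero)
qed

end

theorem theorem8p1:
  fixes m :: "'a::real_vector \<Rightarrow> 'a \<Rightarrow> 'a"
    and h :: "'a \<Rightarrow> 'a \<Rightarrow> real"
  assumes "euclidean_metrized_commutative_algebra m h"
  shows "(negative_sectional_nonassociativity m h \<longrightarrow> finite (metrized_aut m h)) \<and>
    (nonpositive_sectional_nonassociativity m h \<longrightarrow>
      finite (metrized_aut m h) \<or>
      (\<exists>S. is_trivial_subalgebra m S \<and> (dim S = 1 \<or> dim S = 2)))"
proof -
  interpret euclidean_metrized_commutative_algebra m h by fact
  show ?thesis
  proof (intro conjI impI)
    assume neg: "negative_sectional_nonassociativity m h"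
    then have nonpos: "nonpositive_sectional_nonassociativity m h"
      unfolding negative_sectional_nonassociativity_def nonpositive_sectional_nonassociativity_def
      by (auto intro: less_imp_le)
    show "finite (metrized_aut m h)"
    proof (rule ccontr)
      assume "infinite (metrized_aut m h)"
      then obtain e f where ef: "h e e = 1" "h f f = 1" "h e f = 0"
        and null: "m e e = 0" "m e f = 0" "m f f = 0"
        using infinite_aut_imp_null_pair nonpos by blast
      have "sectional_nonassociativity m h e f < 0"
        using neg orthonormal_pair(1)[OF ef]
        by (simp add: negative_sectional_nonassociativity_def)
      then show False by (simp add: sectional_nonassociativity_def null inner_simps)
    qed
  next
    assume nonpos: "nonpositive_sectional_nonassociativity m h"
    show "finite (metrized_aut m h) \<or>
      (\<exists>S. is_trivial_subalgebra m S \<and> (dim S = 1 \<or> dim S = 2))"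
      using infinite_aut_imp_null_pair[OF _ nonpos] span_null_pair_trivial orthonormal_pair(2)
      by metis
  qed
qed

end
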